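(* Let $\mathfrak p_n$ be the $n$th twin prime, let $\Pi_2=\prod_{p\ge 3,\ p\text{ prime}}\left(1-\frac{1}{(p-1)^2}\right)$ be the twin prime constant, and let $C$ be an absolute constant such that, for some absolute constant $c$, $$\pi_2(x)\le \frac{C\,\Pi_2\,x}{(\log x)^2}\left(1+c\,\frac{\log\log x}{\log x}\right)$$ holds for all sufficiently large $x$. Then, for any $1/2<t<1$ and any $C'>C$, there exists a positive integer $N_0$ depending on $t$ and $C'$ such that for any $n_0\ge N_0$, squares of sidelength $\mathfrak p_n^{-t}$ for $n\ge n_0$ can be packed into a square of area $$(C'\Pi_2)^{2t}\sum_{n=n_0}^{\infty}\bigl(n(\log n)^2\bigr)^{-2t}.$$
   Context: A prime $p$ is called a twin prime if at least one of $p-2$, $p+2$ is also prime; $\mathfrak p_n$ denotes the $n$th twin prime in increasing order ($\mathfrak p_1=3,\mathfrak p_2=5,\mathfrak p_3=7,\mathfrak p_4=11,\mathfrak p_5=13,\dots$), and for $x\ge 2$, $\pi_2(x)$ denotes the number of twin primes not exceeding $x$, so that $\pi_2(\mathfrak p_n)=n$. If there are only finitely many twin primes, the family of squares consists only of those $n\ge n_0$ for which $\mathfrak p_n$ exists. A finite or countably infinite family of squares in the plane is packed into a region $\Omega$ if they are all contained in $\Omega$ and have pairwise disjoint interiors. "Squares of sidelength $s_n$ for $n\ge n_0$ can be packed into $\Omega$" means that one can place, for each relevant $n\ge n_0$, one square of sidelength $s_n$ so that the resulting family is packed into $\Omega$. *)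

theory Defs
  imports "HOL-Analysis.Analysis" "HOL-Computational_Algebra.Primes"
begin

text \<open>Truncated subtraction is harmless here: a prime satisfies \<open>p \<ge> 2\<close>, and \<open>0\<close> is not prime.\<close>
definition twin_primes :: "nat set" where
  "twin_primes = {p. prime p \<and> (prime (p - 2) \<or> prime (p + 2))}"

definition pi2 :: "real \<Rightarrow> nat" where
  "pi2 x = card {p \<in> twin_primes. real p \<le> x}"

text \<open>Indices start at 1, whereas \<^const>\<open>enumerate\<close> starts at 0. The value \<open>nth_twin_prime n\<close> is
  meaningful exactly when \<open>twin_prime_index n\<close> holds, which allows for the
  possibility that there are only finitely many twin primes.\<close>
definition nth_twin_prime :: "nat \<Rightarrow> nat" where
  "nth_twin_prime n = enumerate twin_primes (n - 1)"

definition twin_prime_index :: "nat \<Rightarrow> bool" where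
  "twin_prime_index n \<longleftrightarrow> n \<ge> 1 \<and> (infinite twin_primes \<or> n \<le> card twin_primes)"

definition twin_prime_const :: real where
  "twin_prime_const = (\<Prod>p. if prime p \<and> p \<ge> 3 then 1 - 1 / (real p - 1)\<^sup>2 else 1)"

text \<open>Closed squares in the plane of side length \<open>s\<close>, in arbitrary position and orientation: one
  corner is \<open>a\<close>, and the orthonormal vectors \<open>u\<close>, \<open>v\<close> are the directions of the sides at \<open>a\<close>.\<close>
definition is_square :: "real \<Rightarrow> (real^2) set \<Rightarrow> bool" where
  "is_square s S \<longleftrightarrow> s > 0 \<and>
     (\<exists>a u v. norm u = 1 \<and> norm v = 1 \<and> u \<bullet> v = 0 \<and>
        S = {a + x *\<^sub>R u + y *\<^sub>R v | x y. 0 \<le> x \<and> x \<le> s \<and> 0 \<le> y \<and> y \<le> s})"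

definition packed_into :: "('i \<Rightarrow> (real^2) set) \<Rightarrow> 'i set \<Rightarrow> (real^2) set \<Rightarrow> bool" where
  "packed_into Q I \<Omega> \<longleftrightarrow>
     (\<forall>i\<in>I. Q i \<subseteq> \<Omega>) \<and> disjoint_family_on (\<lambda>i. interior (Q i)) I"

definition squares_can_be_packed :: "('i \<Rightarrow> real) \<Rightarrow> 'i set \<Rightarrow> (real^2) set \<Rightarrow> bool" where
  "squares_can_be_packed s I \<Omega> \<longleftrightarrow>
     (\<exists>Q. (\<forall>i\<in>I. is_square (s i) (Q i)) \<and> packed_into Q I \<Omega>)"

end

theory Submission imports Defs begin

text \<open>
  A constant factor of area is left over, so a greedy shelf packing (Meir and Moser) is enough.
  For \<open>K1\<close> strictly between \<open>C \<Pi>\<^sub>2\<close> and \<open>C' \<Pi>\<^sub>2\<close>, the bound on \<open>\<pi>\<^sub>2\<close> at the \<open>n\<close>th twin prime \<open>p\<^sub>n \<ge> n\<close> gives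
  \<open>p\<^sub>n \<ge> n (ln n)\<^sup>2 / K1\<close> for large \<open>n\<close>. Hence the total area of the squares is at most
  \<open>(K1 / (C' \<Pi>\<^sub>2)) powr (2t) < 1\<close> times the area \<open>L\<^sup>2\<close> of the container. Since
  \<open>(n (ln n)\<^sup>2) powr (-2t)\<close> varies slowly, the largest side is \<open>o(L)\<close> as \<open>n\<^sub>0\<close> grows, which pays for
  the waste of the shelves.
\<close>

section \<open>Shelf packing\<close>

text \<open>The state after placing square \<open>n\<close> is \<open>(X, Y, H)\<close>: the lower left corner of square \<open>n\<close>, and
  the height of its shelf.\<close>
primrec shelf :: "real \<Rightarrow> (nat \<Rightarrow> real) \<Rightarrow> nat \<Rightarrow> real \<times> real \<times> real" where
  "shelf a s 0 = (0, 0, s 0)"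
| "shelf a s (Suc n) = (case shelf a s n of (X, Y, H) \<Rightarrow>
     if X + s n + s (Suc n) \<le> a then (X + s n, Y, H) else (0, Y + H, s (Suc n)))"

definition "shelf_x a s n = fst (shelf a s n)"
definition "shelf_y a s n = fst (snd (shelf a s n))"
definition "shelf_h a s n = snd (snd (shelf a s n))"

lemma shelf_0 [simp]: "shelf_x a s 0 = 0" "shelf_y a s 0 = 0" "shelf_h a s 0 = s 0"
  by (simp_all add: shelf_x_def shelf_y_def shelf_h_def)

lemma shelf_Suc_same:
  assumes "shelf_x a s n + s n + s (Suc n) \<le> a"
  shows "shelf_x a s (Suc n) = shelf_x a s n + s n"
    "shelf_y a s (Suc n) = shelf_y a s n" "shelf_h a s (Suc n) = shelf_h a s n"
  using assms by (auto simp: shelf_x_def shelf_y_def shelf_h_def split: prod.splits)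

lemma shelf_Suc_new:
  assumes "\<not> shelf_x a s n + s n + s (Suc n) \<le> a"
  shows "shelf_x a s (Suc n) = 0"
    "shelf_y a s (Suc n) = shelf_y a s n + shelf_h a s n" "shelf_h a s (Suc n) = s (Suc n)"
  using assms by (auto simp: shelf_x_def shelf_y_def shelf_h_def split: prod.splits)

context
  fixes a :: real and s :: "nat \<Rightarrow> real"
  assumes nonneg: "\<And>n. 0 \<le> s n" and anti: "antimono s" and fits: "s 0 \<le> a"
begin

lemma side_le: "s n \<le> s 0"
  using anti by (simp add: antimonoD)

lemma side_Suc_le: "s (Suc n) \<le> s n"
  using anti by (simp add: antimonoD)

text \<open>A shelf takes its height from its first square, so antitonicity makes every later square
  on it low enough; a fresh shelf is wide enough because no side exceeds \<open>s 0\<close>.\<close>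

lemma shelf_bounds:
  "0 \<le> shelf_x a s n \<and> 0 \<le> shelf_y a s n \<and> s n \<le> shelf_h a s n \<and> shelf_x a s n + s n \<le> a"
proof (induction n)
  case 0
  then show ?case using fits by simp
next
  case (Suc n)
  show ?case
  proof (cases "shelf_x a s n + s n + s (Suc n) \<le> a")
    case True
    then show ?thesis
      using Suc nonneg[of n] side_Suc_le[of n] by (simp add: shelf_Suc_same)
  next
    case False
    then show ?thesis
      using Suc nonneg[of n] side_le[of "Suc n"] fits by (simp add: shelf_Suc_new)
  qed
qed

text \<open>The term \<open>shelf_x a s n * s n\<close> bounds from below the area already used on the current shelf;
  when a shelf is closed it is worth at least \<open>a - s 0\<close> times the height of the next one.\<close>
lemma shelf_height_bound:
  "(a - s 0) * (shelf_y a s n + shelf_h a s n - s 0) + shelf_x a s n * s n \<le> (\<Sum>i<n. (s i)\<^sup>2)"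
proof (induction n)
  case 0
  then show ?case by simp
next
  case (Suc n)
  note b = shelf_bounds[of n]
  show ?case
  proof (cases "shelf_x a s n + s n + s (Suc n) \<le> a")
    case True
    \<comment> \<open>The used width grows by \<open>s n\<close> while the next side is no larger,
      so the new summand \<open>(s n)\<^sup>2\<close> pays for the growth.\<close>
    have "(shelf_x a s n + s n) * s (Suc n) \<le> (shelf_x a s n + s n) * s n"
      using b nonneg[of n] side_Suc_le[of n] by (intro mult_left_mono) auto
    then show ?thesis
      using Suc True by (simp add: shelf_Suc_same algebra_simps power2_eq_square)
  next
    case False
    \<comment> \<open>Overflow makes the used width exceed \<open>a - s (Suc n)\<close>, hence
      \<open>a - s 0\<close>; the credit of the closed shelf then pays for the next one.\<close>
    have "(a - s 0) * s (Suc n) \<le> (shelf_x a s n + s n) * s n"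
      using b nonneg[of n] nonneg[of "Suc n"] side_Suc_le[of n] False side_le[of "Suc n"]
      by (intro mult_mono) auto
    then show ?thesis
      using Suc False by (simp add: shelf_Suc_new algebra_simps power2_eq_square)
  qed
qed

lemma shelf_separated:
  assumes "m < n"
  shows "shelf_y a s m + s m \<le> shelf_y a s n \<or>
    shelf_x a s m + s m \<le> shelf_x a s n"
proof -
  \<comment> \<open>Strengthened for the induction: while both squares share a shelf, its position
    and height are remembered, so that opening the next shelf clears the full height.\<close>
  have "shelf_y a s m + shelf_h a s m \<le> shelf_y a s n \<or>
      shelf_y a s n = shelf_y a s m \<and> shelf_h a s n = shelf_h a s m \<and>
        shelf_x a s m + s m \<le> shelf_x a s n"
    using assms
  proof (induction n)
    case 0
    then show ?case by simp
  next
    case (Suc n)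
    note b = shelf_bounds[of n] nonneg[of n]
    show ?case
    proof (cases "m = n")
      case True
      then show ?thesis
        by (cases "shelf_x a s n + s n + s (Suc n) \<le> a") (auto simp: shelf_Suc_same shelf_Suc_new)
    next
      case False
      then have "m < n" using Suc.prems by simp
      then show ?thesis
        using Suc.IH b shelf_Suc_same[of a s n] shelf_Suc_new[of a s n]
        by (cases "shelf_x a s n + s n + s (Suc n) \<le> a") auto
    qed
  qed
  then show ?thesis
    using shelf_bounds[of m] by auto
qed

end

section \<open>Axis-parallel squares\<close>

text \<open>Encoded as a \<open>cbox\<close> so that interior and measure come from the theory of
  boxes.\<close>

definition aligned_square :: "real \<Rightarrow> real \<Rightarrow> real \<Rightarrow> (real^2) set" where
  "aligned_square x y s = cbox (vector [x, y]) (vector [x + s, y + s])"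

lemma mem_aligned_square:
  "p \<in> aligned_square x y s \<longleftrightarrow> x \<le> p$1 \<and> p$1 \<le> x + s \<and> y \<le> p$2 \<and> p$2 \<le> y + s"
  by (auto simp: aligned_square_def mem_box_cart forall_2)

lemma is_square_aligned_square:
  assumes "s > 0"
  shows "is_square s (aligned_square x y s)"
proof -
  let ?u = "axis 1 1 :: real^2" and ?v = "axis 2 1 :: real^2"
  have "aligned_square x y s =
      {vector [x, y] + p *\<^sub>R ?u + q *\<^sub>R ?v | p q. 0 \<le> p \<and> p \<le> s \<and> 0 \<le> q \<and> q \<le> s}"
    (is "_ = ?R")
  proof (intro set_eqI iffI)
    fix w assume w: "w \<in> aligned_square x y s"
    have "w = vector [x, y] + (w$1 - x) *\<^sub>R ?u + (w$2 - y) *\<^sub>R ?v"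
      by (simp add: vec_eq_iff forall_2 axis_def)
    moreover have "0 \<le> w$1 - x \<and> w$1 - x \<le> s \<and> 0 \<le> w$2 - y \<and> w$2 - y \<le> s"
      using w by (auto simp: mem_aligned_square)
    ultimately show "w \<in> ?R" by blast
  next
    fix w assume "w \<in> ?R"
    then show "w \<in> aligned_square x y s"
      by (auto simp: mem_aligned_square axis_def)
  qed
  moreover have "norm ?u = 1" "norm ?v = 1" "?u \<bullet> ?v = 0"
    by (simp_all add: norm_axis_1 inner_axis_axis)
  ultimately show ?thesis
    using assms unfolding is_square_def by blast
qed

lemma measure_aligned_square:
  assumes "s \<ge> 0"
  shows "measure lebesgue (aligned_square x y s) = s\<^sup>2"
proof -
  \<comment> \<open>The corner witnesses the nonemptiness that \<open>content_cbox_cart\<close>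
    requires.\<close>
  have "(vector [x, y] :: real^2) \<in> aligned_square x y s"
    using assms by (simp add: mem_aligned_square)
  then have "measure lborel (aligned_square x y s) = s\<^sup>2"
    unfolding aligned_square_def
    by (subst content_cbox_cart) (auto simp: UNIV_2 power2_eq_square)
  then show ?thesis
    by (simp add: aligned_square_def measure_completion)
qed

lemma disjoint_interior_aligned_square:
  assumes "x + s \<le> x' \<or> y + s \<le> y'"
  shows "interior (aligned_square x y s) \<inter> interior (aligned_square x' y' s') = {}"
  using assms by (fastforce simp: aligned_square_def interior_cbox mem_box_cart forall_2)

text \<open>The area hypothesis turns the shelf height bound into total height at most
  \<open>L\<close>. Zero sides stand for absent squares, so a finite family can be treated as a
  sequence.\<close>

lemma squares_can_be_packed_antimono:
  fixes s :: "nat \<Rightarrow> real"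
  assumes nonneg: "\<And>n. 0 \<le> s n" and anti: "antimono s" and "s 0 < L"
    and area: "\<And>n. (\<Sum>i<n. (s i)\<^sup>2) \<le> (L - s 0)\<^sup>2"
  shows "squares_can_be_packed s {n. s n > 0} (aligned_square 0 0 L)"
proof -
  have fits: "s 0 \<le> L" using assms by simp
  note b = shelf_bounds[OF nonneg anti fits]
  define Q where "Q n = aligned_square (shelf_x L s n) (shelf_y L s n) (s n)" for n
  have top: "shelf_y L s n + s n \<le> L" for n
  proof -
    have "(L - s 0) * (shelf_y L s n + shelf_h L s n - s 0) \<le> (L - s 0) * (L - s 0)"
      using shelf_height_bound[OF nonneg anti fits, of n] area[of n] b[of n] nonneg[of n]
        mult_nonneg_nonneg[of "shelf_x L s n" "s n"]
      unfolding power2_eq_square by linarith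
    then show ?thesis
      using \<open>s 0 < L\<close> b[of n] by (simp add: mult_le_cancel_left)
  qed
  have sep: "interior (Q m) \<inter> interior (Q n) = {}" if "m < n" for m n
    unfolding Q_def using shelf_separated[OF nonneg anti fits that]
    by (intro disjoint_interior_aligned_square) auto
  have "interior (Q m) \<inter> interior (Q n) = {}" if "m \<noteq> n" for m n
    using sep[of m n] sep[of n m] that by (cases m n rule: linorder_cases) auto
  moreover have "Q n \<subseteq> aligned_square 0 0 L" for n
    using b[of n] top[of n] by (auto simp: Q_def mem_aligned_square)
  ultimately show ?thesis
    unfolding squares_can_be_packed_def packed_into_def disjoint_family_on_def
    by (intro exI[of _ Q]) (auto simp: Q_def is_square_aligned_square)
qed

lemma squares_can_be_packed_reindex:
  assumes "squares_can_be_packed s J \<Omega>" "inj_on f I" "f ` I \<subseteq> J" "\<And>i. i \<in> I \<Longrightarrow> s' i = s (f i)"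
  shows "squares_can_be_packed s' I \<Omega>"
proof -
  obtain Q where Q: "\<forall>i\<in>J. is_square (s i) (Q i)" "\<forall>i\<in>J. Q i \<subseteq> \<Omega>"
    "disjoint_family_on (\<lambda>i. interior (Q i)) J"
    using assms(1) unfolding squares_can_be_packed_def packed_into_def by auto
  have "disjoint_family_on (\<lambda>i. interior (Q (f i))) I"
    using Q(3) assms(2,3) unfolding disjoint_family_on_def by (metis image_subset_iff inj_onD)
  then show ?thesis
    unfolding squares_can_be_packed_def packed_into_def
    using Q(1,2) assms(3,4) by (intro exI[of _ "\<lambda>i. Q (f i)"]) auto
qed

section \<open>Twin primes\<close>

text \<open>Positive factors alone only give a nonnegative limit; absolute convergence, by
  comparison with the inverse squares, excludes 0.\<close>

lemma twin_prime_const_pos: "twin_prime_const > 0"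
proof -
  define f :: "nat \<Rightarrow> real" where
    "f p = (if prime p \<and> p \<ge> 3 then 1 - 1 / (real p - 1)\<^sup>2 else 1)" for p
  have pos: "f p > 0" for p
  proof (cases "p \<ge> 3")
    case True
    then have "(real p - 1)\<^sup>2 \<ge> 2\<^sup>2" by (intro power_mono) auto
    then show ?thesis by (simp add: f_def)
  qed (simp add: f_def)
  have "summable (\<lambda>p. norm (f p - 1))"
  proof (rule summable_comparison_test')
    show "summable (\<lambda>p. 4 * (1 / real p ^ 2))"
      using inverse_power_summable[of 2, where ?'a = real]
      by (intro summable_mult) (simp add: inverse_eq_divide)
    show "norm (norm (f p - 1)) \<le> 4 * (1 / real p ^ 2)" if "p \<ge> 3" for p
    proof -
      \<comment> \<open>The factor 4 of the majorant comes from
        \<open>p / 2 \<le> p - 1\<close>.\<close>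
      have "(real p / 2)\<^sup>2 \<le> (real p - 1)\<^sup>2" using that by (intro power_mono) auto
      then have "1 / (real p - 1)\<^sup>2 \<le> 1 / (real p / 2)\<^sup>2"
        using that by (intro divide_left_mono) auto
      then show ?thesis by (auto simp: f_def power_divide)
    qed
  qed
  then have conv: "convergent_prod f"
    by (intro abs_convergent_prod_imp_convergent_prod)
      (simp add: abs_convergent_prod_conv_summable)
  have "prodinf f \<noteq> 0"
    using conv pos by (metis less_irrefl prodinf_nonzero)
  moreover have "prodinf f \<ge> 0"
    by (rule LIMSEQ_le_const[OF convergent_prod_LIMSEQ[OF conv]])
      (intro exI allI impI prod_nonneg less_imp_le[OF pos])
  ultimately show ?thesis
    by (simp add: twin_prime_const_def f_def[abs_def])
qed

lemma three_in_twin_primes: "3 \<in> twin_primes"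
proof -
  have "prime (3::nat)" "prime (5::nat)" by simp_all
  then show ?thesis by (simp add: twin_primes_def)
qed

lemma nth_twin_prime_less:
  assumes "twin_prime_index n" "1 \<le> m" "m < n"
  shows "nth_twin_prime m < nth_twin_prime n"
proof (cases "finite twin_primes")
  case True
  then show ?thesis
    using assms unfolding nth_twin_prime_def twin_prime_index_def
    by (intro finite_enumerate_mono) auto
next
  case False
  then show ?thesis
    using assms unfolding nth_twin_prime_def by (intro enumerate_mono) auto
qed

lemma twin_prime_index_mono:
  "twin_prime_index n \<Longrightarrow> 1 \<le> m \<Longrightarrow> m \<le> n \<Longrightarrow> twin_prime_index m"
  by (auto simp: twin_prime_index_def)

lemma nth_twin_prime_in: "twin_prime_index n \<Longrightarrow> nth_twin_prime n \<in> twin_primes"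
  unfolding nth_twin_prime_def twin_prime_index_def
  by (cases "finite twin_primes") (auto intro: enumerate_in_set finite_enumerate_in_set)

lemma le_pi2_nth_twin_prime:
  assumes "twin_prime_index n"
  shows "n \<le> pi2 (real (nth_twin_prime n))"
proof -
  have "inj_on nth_twin_prime {1..n}"
    using nth_twin_prime_less twin_prime_index_mono[OF assms]
    by (intro linorder_inj_onI) (metis atLeastAtMost_iff less_irrefl, auto)
  moreover have "nth_twin_prime ` {1..n} \<subseteq> {p \<in> twin_primes. real p \<le> real (nth_twin_prime n)}"
    using nth_twin_prime_less[OF assms] nth_twin_prime_in twin_prime_index_mono[OF assms]
    by (auto simp: le_less)
  moreover have "finite {p \<in> twin_primes. real p \<le> real (nth_twin_prime n)}"
    by (rule finite_subset[of _ "{..nth_twin_prime n}"]) auto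
  ultimately show ?thesis
    unfolding pi2_def by (metis card_atLeastAtMost card_inj_on_le diff_Suc_1)
qed

text \<open>This crude bound yields \<open>n \<le> nth_twin_prime n\<close>: large indices give
  large twin primes, and \<open>ln n\<close> may replace the logarithm of the twin prime.\<close>

lemma pi2_le: "pi2 (real n) \<le> n"
proof -
  have "{p \<in> twin_primes. real p \<le> real n} \<subseteq> {1..n}"
    by (auto simp: twin_primes_def dest: prime_gt_0_nat)
  then show ?thesis
    unfolding pi2_def using card_mono[of "{1..n}"] by fastforce
qed

lemma one_le_pi2:
  assumes "x \<ge> 3"
  shows "1 \<le> pi2 x"
proof -
  have "finite {p \<in> twin_primes. real p \<le> x}"
    by (rule finite_subset[of _ "{..nat \<lfloor>x\<rfloor>}"]) (auto simp: le_nat_floor)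
  moreover have "3 \<in> {p \<in> twin_primes. real p \<le> x}"
    using assms three_in_twin_primes by simp
  ultimately show ?thesis
    unfolding pi2_def by (metis One_nat_def Suc_leI card_gt_0_iff empty_iff)
qed

text \<open>The factor \<open>1 + c * (ln (ln x) / ln x)\<close> tends to 1, so the gap between
  \<open>K\<close> and \<open>K1\<close> absorbs it for large \<open>x\<close>, whatever the sign of
  \<open>c\<close>.\<close>

lemma nth_twin_prime_lower_bound:
  fixes K K1 :: real
  assumes "\<forall>\<^sub>F x in at_top. real (pi2 x) \<le> K * x / (ln x)\<^sup>2 * (1 + c * (ln (ln x) / ln x))"
    and "K < K1"
  shows "K1 > 0"
    and "\<forall>\<^sub>F n in sequentially. twin_prime_index n \<longrightarrow>
      real n * (ln (real n))\<^sup>2 / K1 \<le> real (nth_twin_prime n)"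
proof -
  have "((\<lambda>x. K * (1 + c * (ln (ln x) / ln x))) \<longlongrightarrow> K * (1 + c * 0)) at_top"
    by (intro tendsto_intros filterlim_compose[OF ln_x_over_x_tendsto_0 ln_at_top])
  then have "\<forall>\<^sub>F x in at_top. K * (1 + c * (ln (ln x) / ln x)) < K1"
    using assms(2) by (intro order_tendstoD) auto
  with assms(1) eventually_ge_at_top[of 3]
  have "\<forall>\<^sub>F x in at_top. real (pi2 x) \<le> K1 * (x / (ln x)\<^sup>2) \<and> x \<ge> 3"
  proof eventually_elim
    case (elim x)
    have "K * (1 + c * (ln (ln x) / ln x)) * (x / (ln x)\<^sup>2) \<le> K1 * (x / (ln x)\<^sup>2)"
      using elim by (intro mult_right_mono) auto
    then show ?case using elim by (simp add: mult.assoc mult.commute mult.left_commute)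
  qed
  then obtain x0 where x0: "\<And>x. x \<ge> x0 \<Longrightarrow> real (pi2 x) \<le> K1 * (x / (ln x)\<^sup>2) \<and> x \<ge> 3"
    by (auto simp: eventually_at_top_linorder)
  \<comment> \<open>The sign of \<open>K1\<close> is read off from a count that is at least 1, since
    3 is a twin prime.\<close>
  have "1 \<le> pi2 x0" using x0[of x0] one_le_pi2 by auto
  then have "0 < K1 * (x0 / (ln x0)\<^sup>2)" using x0[of x0] by linarith
  moreover have "0 < x0 / (ln x0)\<^sup>2" using x0[of x0] by simp
  ultimately show K1: "K1 > 0" by (rule zero_less_mult_pos2)
  show "\<forall>\<^sub>F n in sequentially. twin_prime_index n \<longrightarrow>
      real n * (ln (real n))\<^sup>2 / K1 \<le> real (nth_twin_prime n)"
    using eventually_ge_at_top[of "nat \<lceil>x0\<rceil>"] eventually_ge_at_top[of 1]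
  proof eventually_elim
    case (elim n)
    show ?case
    proof
      assume ind: "twin_prime_index n"
      let ?p = "nth_twin_prime n"
      have n: "n \<le> pi2 (real ?p)" using ind by (rule le_pi2_nth_twin_prime)
      also have "\<dots> \<le> ?p" by (rule pi2_le)
      finally have np: "n \<le> ?p" .
      have p: "real ?p \<ge> x0" using elim np by linarith
      have ln: "0 \<le> ln (real n)" "ln (real n) \<le> ln (real ?p)" "0 < ln (real ?p)"
        using x0[OF p] np elim by auto
      have "real n \<le> K1 * (real ?p / (ln (real ?p))\<^sup>2)"
        using x0[OF p] n by linarith
      then have "real n * (ln (real ?p))\<^sup>2 \<le> K1 * real ?p"
        using ln by (simp add: field_simps)
      moreover have "real n * (ln (real n))\<^sup>2 \<le> real n * (ln (real ?p))\<^sup>2"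
        using ln by (intro mult_left_mono power_mono) auto
      ultimately show "real n * (ln (real n))\<^sup>2 / K1 \<le> real ?p"
        using K1 by (simp add: field_simps)
    qed
  qed
qed

section \<open>The tail of the series\<close>

context
  fixes t :: real
  assumes t: "1/2 < t" "t < 1"
begin

text \<open>As \<open>exp 1 \<le> 3\<close>, the logarithm is at least 1 from \<open>n = 3\<close>
  on, and \<open>2 * t > 1\<close> leaves a convergent majorant.\<close>

lemma summable_on_tail:
  "(\<lambda>n. (real n * (ln (real n))\<^sup>2) powr (- 2 * t)) summable_on {n0..}"
proof -
  have "summable (\<lambda>n. norm ((real n * (ln (real n))\<^sup>2) powr (- 2 * t)))"
  proof (rule summable_comparison_test')
    show "summable (\<lambda>n. real n powr (- 2 * t))"
      using t by (simp add: summable_real_powr_iff)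
    show "norm (norm ((real n * (ln (real n))\<^sup>2) powr (- 2 * t))) \<le> real n powr (- 2 * t)"
      if "n \<ge> 3" for n
    proof -
      have "exp 1 \<le> real n" using exp_le that by linarith
      then have "1 \<le> ln (real n)" using that by (simp add: ln_ge_iff)
      then have "real n * 1 \<le> real n * (ln (real n))\<^sup>2"
        by (intro mult_left_mono) auto
      then show ?thesis using that t by (auto intro!: powr_mono2')
    qed
  qed
  then show ?thesis
    by (rule summable_on_subset_banach[OF norm_summable_imp_summable_on]) simp
qed

text \<open>Up to \<open>2 * n0\<close> the terms lose at most a factor 64, and
  \<open>M \<le> n0\<close> of them are counted. Hence the first term becomes an arbitrarily small
  fraction of the tail.\<close>

lemma tail_ge_first_term:
  fixes M n0 :: nat
  assumes "M \<le> n0" "2 \<le> n0"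
  shows "real M / 64 * (real n0 * (ln (real n0))\<^sup>2) powr (- 2 * t)
    \<le> (\<Sum>\<^sub>\<infinity>n\<in>{n0..}. (real n * (ln (real n))\<^sup>2) powr (- 2 * t))"
proof -
  let ?g = "\<lambda>n. real n * (ln (real n))\<^sup>2"
  let ?a = "\<lambda>n. ?g n powr (- 2 * t)"
  have lower: "?a n0 / 64 \<le> ?a n" if n: "n \<in> {n0..<n0 + M}" for n
  proof -
    \<comment> \<open>Here \<open>n0 \<ge> 2\<close> gives \<open>n \<le> n0 * n0\<close>, so the
      logarithm at most doubles.\<close>
    have "real n \<le> 2 * real n0" using n assms by auto
    also have "\<dots> \<le> real n0 * real n0" using assms by (intro mult_right_mono) auto
    finally have "ln (real n) \<le> ln (real n0 * real n0)"
      using n assms by (subst ln_le_cancel_iff) auto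
    then have ln: "ln (real n) \<le> 2 * ln (real n0)" "0 < ln (real n0)" "0 < ln (real n)"
      using n assms by (auto simp: ln_mult)
    have "?g n \<le> (2 * real n0) * (2 * ln (real n0))\<^sup>2"
      using n assms ln by (intro mult_mono power_mono) auto
    then have "?g n \<le> 8 * ?g n0" by (simp add: power_mult_distrib)
    then have "(8 * ?g n0) powr (- 2 * t) \<le> ?a n"
      using t n assms ln by (intro powr_mono2') auto
    moreover have "1 / 64 \<le> (8::real) powr (- 2 * t)"
    proof -
      \<comment> \<open>The hypothesis \<open>t < 1\<close> enters here: \<open>8 powr (-2)\<close>
        is the constant 1/64.\<close>
      have "(8::real) powr (-2) \<le> 8 powr (- 2 * t)" using t by (intro powr_mono) auto
      then show ?thesis by (simp add: powr_minus powr_numeral)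
    qed
    then have "1 / 64 * ?a n0 \<le> 8 powr (- 2 * t) * ?a n0"
      by (intro mult_right_mono) auto
    ultimately show ?thesis by (simp add: powr_mult)
  qed
  have "real M / 64 * ?a n0 = (\<Sum>n\<in>{n0..<n0 + M}. ?a n0 / 64)" by simp
  also have "\<dots> \<le> (\<Sum>n\<in>{n0..<n0 + M}. ?a n)" by (intro sum_mono lower)
  also have "\<dots> \<le> (\<Sum>\<^sub>\<infinity>n\<in>{n0..}. ?a n)"
    by (intro finite_sum_le_infsum summable_on_tail) auto
  finally show ?thesis .
qed

text \<open>The constant \<open>64 * (k / (k' - k))\<^sup>2\<close> makes the largest side \<open>k * sqrt a\<close> at most
  \<open>(k' - k) * sqrt T\<close>, where \<open>a\<close> is the first term of the series and \<open>T\<close> its sum.\<close>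
lemma twin_squares_packed:
  fixes K K' :: real and M n0 :: nat
  defines "k \<equiv> K powr t" and "k' \<equiv> K' powr t"
  defines "T \<equiv> \<Sum>\<^sub>\<infinity>n\<in>{n0..}. (real n * (ln (real n))\<^sup>2) powr (- 2 * t)"
  assumes K: "0 < K" "K < K'"
    and M: "64 * (k / (k' - k))\<^sup>2 \<le> real M" "0 < M" and n0: "M \<le> n0" "2 \<le> n0"
    and low: "\<And>n. n \<ge> n0 \<Longrightarrow> twin_prime_index n \<Longrightarrow>
      real n * (ln (real n))\<^sup>2 / K \<le> real (nth_twin_prime n)"
  shows "\<exists>s \<Omega>. is_square s \<Omega> \<and> measure lebesgue \<Omega> = K' powr (2 * t) * T \<and>
    squares_can_be_packed (\<lambda>n. real (nth_twin_prime n) powr (- t))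
      {n. n \<ge> n0 \<and> twin_prime_index n} \<Omega>"
proof -
  let ?a = "\<lambda>n. (real n * (ln (real n))\<^sup>2) powr (- 2 * t)"
  define s where "s i = (if twin_prime_index (n0 + i)
    then real (nth_twin_prime (n0 + i)) powr (- t) else 0)" for i
  define L where "L = k' * sqrt T"
  have k: "0 < k" "k < k'"
    using K t by (auto simp: k_def k'_def intro!: powr_less_mono2)
  \<comment> \<open>\<open>n0 \<ge> 2\<close> keeps the logarithm nonzero;
    \<open>0 powr (- 2 * t)\<close> would be 0.\<close>
  have a_pos: "?a n > 0" if "n \<ge> n0" for n
    using that n0 by auto
  have tail: "real M / 64 * ?a n0 \<le> T"
    unfolding T_def using n0 by (rule tail_ge_first_term)
  moreover have "0 < real M / 64 * ?a n0"
    using a_pos[of n0] M by (intro mult_pos_pos) auto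
  ultimately have T: "T > 0" by linarith
  have sq: "(s i)\<^sup>2 \<le> k\<^sup>2 * ?a (n0 + i)" for i
  proof (cases "twin_prime_index (n0 + i)")
    case True
    let ?g = "real (n0 + i) * (ln (real (n0 + i)))\<^sup>2"
    have g: "0 < ?g" using n0 by auto
    have "(s i)\<^sup>2 = real (nth_twin_prime (n0 + i)) powr (- 2 * t)"
      using True by (simp add: s_def power2_eq_square flip: powr_add)
    also have "\<dots> \<le> (?g / K) powr (- 2 * t)"
      using low[OF _ True] g K t by (intro powr_mono2') auto
    also have "\<dots> = K powr (2 * t) * ?g powr (- 2 * t)"
      using g K by (simp add: powr_divide powr_minus divide_simps)
    also have "K powr (2 * t) = k\<^sup>2"
      by (simp add: k_def power2_eq_square flip: powr_add)
    finally show ?thesis .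
  qed (simp add: s_def)
  have area: "(\<Sum>i<m. (s i)\<^sup>2) \<le> (k * sqrt T)\<^sup>2" for m
  proof -
    have "(\<Sum>i<m. (s i)\<^sup>2) \<le> (\<Sum>i<m. k\<^sup>2 * ?a (n0 + i))"
      by (intro sum_mono sq)
    also have "\<dots> = k\<^sup>2 * (\<Sum>n\<in>(+) n0 ` {..<m}. ?a n)"
      by (subst sum.reindex) (auto simp: sum_distrib_left)
    also have "\<dots> \<le> k\<^sup>2 * T"
      unfolding T_def by (intro mult_left_mono finite_sum_le_infsum summable_on_tail) auto
    also have "\<dots> = (k * sqrt T)\<^sup>2"
      using T by (simp add: power_mult_distrib)
    finally show ?thesis .
  qed
  have first: "s 0 \<le> (k' - k) * sqrt T"
  proof (rule power2_le_imp_le)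
    have "k\<^sup>2 * ?a n0 = (k' - k)\<^sup>2 * ((64 * (k / (k' - k))\<^sup>2) / 64 * ?a n0)"
      using k by (simp add: power_divide)
    also have "\<dots> \<le> (k' - k)\<^sup>2 * (real M / 64 * ?a n0)"
      using M by (intro mult_left_mono mult_right_mono divide_right_mono) auto
    also have "\<dots> \<le> (k' - k)\<^sup>2 * T"
      using tail by (intro mult_left_mono) auto
    finally show "(s 0)\<^sup>2 \<le> ((k' - k) * sqrt T)\<^sup>2"
      using sq[of 0] T by (simp add: power_mult_distrib)
  qed (use k T in simp)
  \<comment> \<open>\<open>L\<close> splits into \<open>(k' - k) * sqrt T\<close>, which
    accommodates the largest side, and \<open>k * sqrt T\<close>, whose square bounds the total
    area.\<close>
  have L: "k * sqrt T \<le> L - s 0" "0 < k * sqrt T"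
    using first k T by (auto simp: L_def algebra_simps)
  have nonneg: "0 \<le> s n" for n by (simp add: s_def)
  have "antimono s"
  proof (rule antimonoI)
    fix m n :: nat assume "m \<le> n"
    show "s n \<le> s m"
    proof (cases "twin_prime_index (n0 + n)")
      case True
      have m: "twin_prime_index (n0 + m)"
        using twin_prime_index_mono[OF True] \<open>m \<le> n\<close> n0 by auto
      have "nth_twin_prime (n0 + m) \<le> nth_twin_prime (n0 + n)"
        using nth_twin_prime_less[OF True, of "n0 + m"] \<open>m \<le> n\<close> n0 by (cases "m = n") auto
      moreover have "nth_twin_prime (n0 + m) > 0"
        using nth_twin_prime_in[OF m] by (auto simp: twin_primes_def dest: prime_gt_0_nat)
      ultimately show ?thesis
        using True m t by (auto simp: s_def intro!: powr_mono2')
    qed (simp add: s_def)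
  qed
  moreover have "(\<Sum>i<n. (s i)\<^sup>2) \<le> (L - s 0)\<^sup>2" for n
    using area[of n] power_mono[OF L(1), of 2] L(2) by linarith
  ultimately have "squares_can_be_packed s {n. s n > 0} (aligned_square 0 0 L)"
    using L nonneg by (intro squares_can_be_packed_antimono) auto
  then have "squares_can_be_packed (\<lambda>n. real (nth_twin_prime n) powr (- t))
      {n. n \<ge> n0 \<and> twin_prime_index n} (aligned_square 0 0 L)"
  proof (rule squares_can_be_packed_reindex[where f = "\<lambda>n. n - n0"])
    show "inj_on (\<lambda>n. n - n0) {n. n \<ge> n0 \<and> twin_prime_index n}"
      by (auto simp: inj_on_def)
    show "(\<lambda>n. n - n0) ` {n. n \<ge> n0 \<and> twin_prime_index n} \<subseteq> {n. s n > 0}"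
      using nth_twin_prime_in by (auto simp: s_def twin_primes_def dest: prime_gt_0_nat)
  qed (auto simp: s_def)
  moreover have "L > 0" using L nonneg[of 0] by linarith
  moreover have "L\<^sup>2 = K' powr (2 * t) * T"
  proof -
    have "K' powr (2 * t) = k'\<^sup>2"
      by (simp add: k'_def power2_eq_square flip: powr_add)
    then show ?thesis using T by (simp add: L_def power_mult_distrib)
  qed
  ultimately show ?thesis
    by (intro exI[of _ L] exI[of _ "aligned_square 0 0 L"])
      (simp add: is_square_aligned_square measure_aligned_square)
qed

end

theorem corollary5p2:
  fixes C :: real
  assumes "\<exists>c::real. \<forall>\<^sub>F x::real in at_top.
    real (pi2 x) \<le> C * twin_prime_const * x / (ln x)\<^sup>2 * (1 + c * (ln (ln x) / ln x))"
  shows "\<forall>(t::real) (C'::real). 1/2 < t \<and> t < 1 \<and> C' > C \<longrightarrow>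
    (\<exists>N\<^sub>0::nat. N\<^sub>0 > 0 \<and> (\<forall>n\<^sub>0\<ge>N\<^sub>0. \<exists>s \<Omega>. is_square s \<Omega> \<and>
       measure lebesgue \<Omega> =
         (C' * twin_prime_const) powr (2 * t) *
         (\<Sum>\<^sub>\<infinity>n\<in>{n\<^sub>0..}. (real n * (ln (real n))\<^sup>2) powr (- 2 * t)) \<and>
       squares_can_be_packed (\<lambda>n. real (nth_twin_prime n) powr (- t))
         {n. n \<ge> n\<^sub>0 \<and> twin_prime_index n} \<Omega>))"
proof (intro allI impI, elim conjE)
  fix t C' :: real
  assume t: "1/2 < t" "t < 1" and C': "C < C'"
  define K' where "K' = C' * twin_prime_const"
  have "C * twin_prime_const < K'"
    unfolding K'_def using C' twin_prime_const_pos by simp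
  \<comment> \<open>The gap below \<open>K1\<close> absorbs the error factor in the bound on
    \<open>pi2\<close>; the gap up to \<open>K'\<close> pays for the waste of the packing.\<close>
  then obtain K1 where K1: "C * twin_prime_const < K1" "K1 < K'"
    using dense by blast
  obtain c where c: "\<forall>\<^sub>F x::real in at_top.
      real (pi2 x) \<le> C * twin_prime_const * x / (ln x)\<^sup>2 * (1 + c * (ln (ln x) / ln x))"
    using assms by blast
  note low = nth_twin_prime_lower_bound[OF c K1(1)]
  obtain N where N: "\<And>n. n \<ge> N \<Longrightarrow> twin_prime_index n \<Longrightarrow>
      real n * (ln (real n))\<^sup>2 / K1 \<le> real (nth_twin_prime n)"
    using low(2) by (auto simp: eventually_sequentially)
  obtain M :: nat where M: "64 * (K1 powr t / (K' powr t - K1 powr t))\<^sup>2 < real M"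
    using reals_Archimedean2 by blast
  then have "0 < real M" by (rule le_less_trans[rotated]) simp
  then show "\<exists>N\<^sub>0::nat. N\<^sub>0 > 0 \<and> (\<forall>n\<^sub>0\<ge>N\<^sub>0. \<exists>s \<Omega>. is_square s \<Omega> \<and>
       measure lebesgue \<Omega> =
         (C' * twin_prime_const) powr (2 * t) *
         (\<Sum>\<^sub>\<infinity>n\<in>{n\<^sub>0..}. (real n * (ln (real n))\<^sup>2) powr (- 2 * t)) \<and>
       squares_can_be_packed (\<lambda>n. real (nth_twin_prime n) powr (- t))
         {n. n \<ge> n\<^sub>0 \<and> twin_prime_index n} \<Omega>)"
    \<comment> \<open>In the witness, \<open>N\<close> secures the lower bound on twin primes,
      \<open>M\<close> provides enough comparable terms, and 2 keeps the logarithm positive.\<close>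
    using t low(1) K1(2) M N unfolding K'_def[symmetric]
    by (intro exI[of _ "max (max M N) 2"] conjI allI impI twin_squares_packed[where K = K1 and M = M])
      auto
qed

end
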